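(* Let $A$ be a proper subset of a set $D$ such that $a\in A$ and $0\in A$. Define binary operations on $D$ by $$x\dashv y=0\ \text{ for all } x,y\in D,\qquad x\vdash y=\begin{cases}y,&\text{if } y\in A,\\ a,&\text{if } y\in D\setminus A.\end{cases}$$ Then $(D,\dashv,\vdash)$ is a rectangular dimonoid with empty halo and $\mathrm{Aut}(D,\dashv,\vdash)\cong S_{A\setminus\{0,a\}}\times S_{D\setminus A}$. Moreover, if $|A|>1$, then $(D,\dashv,\vdash)$ is a nonabelian noncommutative dimonoid.
   Context: A dimonoid is a set $D$ with two associative binary operations $\dashv,\vdash$ satisfying, for all $x,y,z\in D$: $(D_1)$ $(x\dashv y)\dashv z=x\dashv(y\vdash z)$; $(D_2)$ $(x\vdash y)\dashv z=x\vdash(y\dashv z)$; $(D_3)$ $(x\dashv y)\vdash z=x\vdash(y\vdash z)$. A dimonoid is commutative if both $\dashv$ and $\vdash$ are commutative (noncommutative means not commutative). It is abelian if $x\dashv y=y\vdash x$ for all $x,y$ (nonabelian means not abelian). It is rectangular if both semigroups $(D,\dashv)$ and $(D,\vdash)$ are rectangular, where a semigroup $(S,* )$ is rectangular if $x*y*z=x*z$ for all $x,y,z\in S$. The halo of a dimonoid is the set of its bar-units, i.e. elements $e$ with $e\vdash d=d=d\dashv e$ for all $d\in D$. $\mathrm{Aut}(D,\dashv,\vdash)$ is the group of bijections $D\to D$ preserving both operations. The elements $a$ and $0$ of $A$ are allowed to coincide. $S_X$ denotes the group of all permutations of the set $X$ (the trivial group if $X=\emptyset$). *)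

theory Defs
  imports "HOL-Algebra.Bij"
begin

text \<open>
  Semigroups and dimonoids are given by an explicit carrier set together with total HOL
  functions; only the values of the operations on the carrier matter.
\<close>

locale carrier_semigroup =
  fixes S :: "'a set" and f :: "'a \<Rightarrow> 'a \<Rightarrow> 'a" (infixl \<open>\<star>\<close> 70)
  assumes closed: "\<lbrakk>x \<in> S; y \<in> S\<rbrakk> \<Longrightarrow> x \<star> y \<in> S"
    and assoc: "\<lbrakk>x \<in> S; y \<in> S; z \<in> S\<rbrakk> \<Longrightarrow> (x \<star> y) \<star> z = x \<star> (y \<star> z)"

locale rectangular_semigroup = carrier_semigroup +
  assumes rectangular: "\<lbrakk>x \<in> S; y \<in> S; z \<in> S\<rbrakk> \<Longrightarrow> x \<star> y \<star> z = x \<star> z"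

locale dimonoid =
  left: carrier_semigroup D left_op + right: carrier_semigroup D right_op
  for D :: "'a set"
    and left_op :: "'a \<Rightarrow> 'a \<Rightarrow> 'a" (infixl \<open>\<stileturn>\<close> 70)
    and right_op :: "'a \<Rightarrow> 'a \<Rightarrow> 'a" (infixl \<open>\<turnstile>\<close> 70) +
  assumes D1: "\<lbrakk>x \<in> D; y \<in> D; z \<in> D\<rbrakk> \<Longrightarrow> (x \<stileturn> y) \<stileturn> z = x \<stileturn> (y \<turnstile> z)"
    and D2: "\<lbrakk>x \<in> D; y \<in> D; z \<in> D\<rbrakk> \<Longrightarrow> (x \<turnstile> y) \<stileturn> z = x \<turnstile> (y \<stileturn> z)"
    and D3: "\<lbrakk>x \<in> D; y \<in> D; z \<in> D\<rbrakk> \<Longrightarrow> (x \<stileturn> y) \<turnstile> z = x \<turnstile> (y \<turnstile> z)"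

locale rectangular_dimonoid = dimonoid +
  assumes rectangular_left: "rectangular_semigroup D left_op"
    and rectangular_right: "rectangular_semigroup D right_op"

locale commutative_dimonoid = dimonoid +
  assumes left_commute: "\<lbrakk>x \<in> D; y \<in> D\<rbrakk> \<Longrightarrow> x \<stileturn> y = y \<stileturn> x"
    and right_commute: "\<lbrakk>x \<in> D; y \<in> D\<rbrakk> \<Longrightarrow> x \<turnstile> y = y \<turnstile> x"

locale abelian_dimonoid = dimonoid +
  assumes abelian: "\<lbrakk>x \<in> D; y \<in> D\<rbrakk> \<Longrightarrow> x \<stileturn> y = y \<turnstile> x"

definition halo :: "'a set \<Rightarrow> ('a \<Rightarrow> 'a \<Rightarrow> 'a) \<Rightarrow> ('a \<Rightarrow> 'a \<Rightarrow> 'a) \<Rightarrow> 'a set"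
  where "halo D left_op right_op =
    {e \<in> D. \<forall>d\<in>D. right_op e d = d \<and> left_op d e = d}"

definition dimonoid_auto ::
    "'a set \<Rightarrow> ('a \<Rightarrow> 'a \<Rightarrow> 'a) \<Rightarrow> ('a \<Rightarrow> 'a \<Rightarrow> 'a) \<Rightarrow> ('a \<Rightarrow> 'a) set"
  where "dimonoid_auto D left_op right_op =
    {h \<in> Bij D. \<forall>x\<in>D. \<forall>y\<in>D. h (left_op x y) = left_op (h x) (h y) \<and>
                              h (right_op x y) = right_op (h x) (h y)}"

definition dimonoid_AutGroup ::
    "'a set \<Rightarrow> ('a \<Rightarrow> 'a \<Rightarrow> 'a) \<Rightarrow> ('a \<Rightarrow> 'a \<Rightarrow> 'a) \<Rightarrow> ('a \<Rightarrow> 'a) monoid"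
  where "dimonoid_AutGroup D left_op right_op =
    BijGroup D\<lparr>carrier := dimonoid_auto D left_op right_op\<rparr>"

lemma (in dimonoid) group_dimonoid_AutGroup:
  "group (dimonoid_AutGroup D left_op right_op)"
proof -
  have sub: "dimonoid_auto D left_op right_op \<subseteq> Bij D"
    by (auto simp: dimonoid_auto_def)
  have "subgroup (dimonoid_auto D left_op right_op) (BijGroup D)"
  proof (rule subgroup.intro)
    show "dimonoid_auto D left_op right_op \<subseteq> carrier (BijGroup D)"
      using sub by (simp add: BijGroup_def)
    show "\<one>\<^bsub>BijGroup D\<^esub> \<in> dimonoid_auto D left_op right_op"
      by (simp add: BijGroup_def dimonoid_auto_def id_Bij left.closed right.closed)
  next
    fix g h
    assume gh: "g \<in> dimonoid_auto D left_op right_op" "h \<in> dimonoid_auto D left_op right_op"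
    then have B: "g \<in> Bij D" "h \<in> Bij D" using sub by auto
    have hD: "h x \<in> D" if "x \<in> D" for x
      using Bij_imp_funcset[OF B(2)] that by auto
    show "g \<otimes>\<^bsub>BijGroup D\<^esub> h \<in> dimonoid_auto D left_op right_op"
      using gh B hD
      by (simp add: BijGroup_def dimonoid_auto_def compose_Bij compose_eq left.closed right.closed)
  next
    fix h
    assume h: "h \<in> dimonoid_auto D left_op right_op"
    then have B: "h \<in> Bij D" using sub by auto
    show "inv\<^bsub>BijGroup D\<^esub> h \<in> dimonoid_auto D left_op right_op"
      using h B Bij_inv_into_lemma[of D h left_op] Bij_inv_into_lemma[of D h right_op]
      by (simp add: inv_BijGroup dimonoid_auto_def restrict_inv_into_Bij left.closed right.closed
          Pi_iff)
  qed
  then show ?thesis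
    unfolding dimonoid_AutGroup_def by (rule subgroup.subgroup_is_group[OF _ group_BijGroup])
qed

end

theory Submission
  imports Defs
begin

text \<open>
  An automorphism fixes \<open>0\<close>, the only value of \<open>\<stileturn>\<close>. As \<open>A\<close> is the set of values of \<open>\<turnstile>\<close>, an
  automorphism preserves \<open>A\<close>, hence also \<open>D - A\<close>, and applying it to \<open>y \<turnstile> y = a\<close> with
  \<open>y \<in> D - A\<close> shows that it fixes \<open>a\<close>. Conversely, every bijection with these properties is an
  automorphism, and such bijections are glued from arbitrary permutations of \<open>A - {0, a}\<close>
  and \<open>D - A\<close>.
\<close>

lemma Bij_iff: "f \<in> Bij S \<longleftrightarrow> f \<in> extensional S \<and> bij_betw f S S"
  by (auto simp: Bij_def)

text \<open>Only inclusions are required of the images: surjectivity onto each block is automatic,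
  as the blocks and the set of points held fixed partition \<open>D\<close>.\<close>

definition block_bijs :: "'a set \<Rightarrow> 'a set \<Rightarrow> 'a set \<Rightarrow> ('a \<Rightarrow> 'a) set"
  where "block_bijs D U V =
    {h \<in> Bij D. h ` U \<subseteq> U \<and> h ` V \<subseteq> V \<and> (\<forall>x\<in>D - (U \<union> V). h x = x)}"

text \<open>A preimage of a point of \<open>U\<close> cannot lie in \<open>V\<close>, which is
  mapped into \<open>V\<close>, nor outside \<open>U \<union> V\<close>, where \<open>h\<close> is
  the identity. So it lies in \<open>U\<close>, and no finiteness is involved.\<close>

lemma restrict_block_Bij:
  assumes "h \<in> block_bijs D U V" "U \<subseteq> D" "U \<inter> V = {}"
  shows "restrict h U \<in> Bij U"
proof -
  have inj: "inj_on h D" and sur: "h ` D = D"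
    using assms(1) by (auto simp: block_bijs_def Bij_iff bij_betw_def)
  have "y \<in> h ` U" if "y \<in> U" for y
  proof -
    obtain x where x: "x \<in> D" "y = h x"
      using \<open>y \<in> U\<close> assms(2) sur by blast
    with that assms show ?thesis
      by (cases "x \<in> U"; cases "x \<in> V") (auto simp: block_bijs_def)
  qed
  then have "h ` U = U"
    using assms(1) by (auto simp: block_bijs_def)
  with inj assms(2) show ?thesis
    by (auto simp: Bij_iff bij_betw_def inj_on_subset)
qed

lemma block_bijs_swap: "block_bijs D U V = block_bijs D V U"
  by (auto simp: block_bijs_def)

text \<open>Three bijections on disjoint blocks are combined: \<open>f\<close>, \<open>g\<close> and
  the identity on the rest. This yields surjectivity of the restriction map below.\<close>

lemma block_bijs_glue:
  assumes f: "f \<in> Bij U" and g: "g \<in> Bij V"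
    and sub: "U \<subseteq> D" "V \<subseteq> D" and disj: "U \<inter> V = {}"
  shows "(\<lambda>x\<in>D. if x \<in> U then f x else if x \<in> V then g x else x) \<in> block_bijs D U V"
    (is "?h \<in> _")
proof -
  have "bij_betw ?h U U"
    using f sub by (subst bij_betw_cong[where g = f]) (auto simp: Bij_iff)
  moreover have "bij_betw ?h V V"
    using g sub disj by (subst bij_betw_cong[where g = g]) (auto simp: Bij_iff)
  ultimately have UV: "bij_betw ?h (U \<union> V) (U \<union> V)"
    using disj by (rule bij_betw_combine)
  have "bij_betw ?h (D - (U \<union> V)) (D - (U \<union> V))"
    by (subst bij_betw_cong[where g = id]) auto
  with UV have "bij_betw ?h (U \<union> V \<union> (D - (U \<union> V))) (U \<union> V \<union> (D - (U \<union> V)))"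
    by (rule bij_betw_combine) blast
  moreover have "U \<union> V \<union> (D - (U \<union> V)) = D"
    using sub by blast
  ultimately have "bij_betw ?h D D"
    by simp
  then have "?h \<in> Bij D"
    by (simp add: Bij_iff)
  moreover have "f ` U \<subseteq> U" "g ` V \<subseteq> V"
    using f g by (auto simp: Bij_iff bij_betw_def)
  ultimately show ?thesis
    using sub disj by (auto simp: block_bijs_def)
qed

text \<open>The isomorphism restricts a map to the two blocks. It is injective because everything
  outside them is fixed, and gluing provides preimages.\<close>

lemma block_bijs_iso:
  assumes sub: "U \<subseteq> D" "V \<subseteq> D" and disj: "U \<inter> V = {}"
  shows "BijGroup D\<lparr>carrier := block_bijs D U V\<rparr> \<cong> BijGroup U \<times>\<times> BijGroup V"
proof -
  let ?r = "\<lambda>h. (restrict h U, restrict h V)"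
  have rU: "restrict h U \<in> Bij U" and rV: "restrict h V \<in> Bij V"
    if "h \<in> block_bijs D U V" for h
    using that sub disj restrict_block_Bij[of h D U V] restrict_block_Bij[of h D V U]
    by (auto simp: block_bijs_swap[of D V U])
  have hom: "?r \<in> hom (BijGroup D\<lparr>carrier := block_bijs D U V\<rparr>) (BijGroup U \<times>\<times> BijGroup V)"
  proof (rule homI)
    fix g h
    assume "g \<in> carrier (BijGroup D\<lparr>carrier := block_bijs D U V\<rparr>)"
      and "h \<in> carrier (BijGroup D\<lparr>carrier := block_bijs D U V\<rparr>)"
    then have gh: "g \<in> block_bijs D U V" "h \<in> block_bijs D U V"
      by auto
    then have gh': "g \<in> Bij D" "h \<in> Bij D" "h ` U \<subseteq> U" "h ` V \<subseteq> V"
      by (auto simp: block_bijs_def)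
    \<comment> \<open>Restriction commutes with composition because \<open>h\<close> maps each block
      into itself.\<close>
    have "restrict (compose D g h) U = compose U (restrict g U) (restrict h U)"
      "restrict (compose D g h) V = compose V (restrict g V) (restrict h V)"
      using gh' sub by (auto simp: compose_def restrict_def fun_eq_iff)
    with gh gh' show "?r (g \<otimes>\<^bsub>BijGroup D\<lparr>carrier := block_bijs D U V\<rparr>\<^esub> h)
        = ?r g \<otimes>\<^bsub>BijGroup U \<times>\<times> BijGroup V\<^esub> ?r h"
      by (simp add: BijGroup_def DirProd_def rU rV)
  qed (auto simp: BijGroup_def DirProd_def rU rV)
  have "inj_on ?r (block_bijs D U V)"
  proof (rule inj_onI)
    fix g h
    assume gh: "g \<in> block_bijs D U V" "h \<in> block_bijs D U V" and eq: "?r g = ?r h"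
    from eq have "g x = h x" if "x \<in> U \<union> V" for x
      using that by (auto dest: fun_cong[where x = x] simp: restrict_def)
    with gh have "g x = h x" if "x \<in> D" for x
      using that by (cases "x \<in> U \<union> V") (auto simp: block_bijs_def)
    with gh show "g = h"
      by (auto simp: block_bijs_def Bij_iff intro: extensionalityI)
  qed
  moreover have "Bij U \<times> Bij V \<subseteq> ?r ` block_bijs D U V"
  proof safe
    fix f g
    assume fg: "f \<in> Bij U" "g \<in> Bij V"
    let ?h = "\<lambda>x\<in>D. if x \<in> U then f x else if x \<in> V then g x else x"
    \<comment> \<open>Both sides are extensional on \<open>U\<close>, so comparing them on
      \<open>U\<close> suffices.\<close>
    have "restrict ?h U = f"
      using fg sub by (intro extensionalityI[where A = U]) (auto simp: Bij_iff)
    moreover have "restrict ?h V = g"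
      using fg sub disj by (intro extensionalityI[where A = V]) (auto simp: Bij_iff)
    ultimately show "(f, g) \<in> ?r ` block_bijs D U V"
      using block_bijs_glue[OF fg sub disj] by (intro image_eqI[where x = ?h]) simp_all
  qed
  moreover have "?r ` block_bijs D U V \<subseteq> Bij U \<times> Bij V"
    using rU rV by auto
  ultimately have "bij_betw ?r (block_bijs D U V) (Bij U \<times> Bij V)"
    by (auto simp: bij_betw_def)
  with hom have "?r \<in> iso (BijGroup D\<lparr>carrier := block_bijs D U V\<rparr>) (BijGroup U \<times>\<times> BijGroup V)"
    by (simp add: iso_def BijGroup_def DirProd_def)
  then show ?thesis
    by (rule is_isoI)
qed

lemma dimonoid_auto_eq_block_bijs:
  fixes left_op :: "'a \<Rightarrow> 'a \<Rightarrow> 'a" (infixl \<open>\<stileturn>\<close> 70)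
    and right_op :: "'a \<Rightarrow> 'a \<Rightarrow> 'a" (infixl \<open>\<turnstile>\<close> 70)
  assumes A: "A \<subset> D" "a \<in> A" "zero \<in> A"
    and left: "\<And>x y. \<lbrakk>x \<in> D; y \<in> D\<rbrakk> \<Longrightarrow> x \<stileturn> y = zero"
    and right: "\<And>x y. \<lbrakk>x \<in> D; y \<in> D\<rbrakk> \<Longrightarrow> x \<turnstile> y = (if y \<in> A then y else a)"
  shows "dimonoid_auto D (\<stileturn>) (\<turnstile>) = block_bijs D (A - {zero, a}) (D - A)"
proof (intro subset_antisym subsetI)
  fix h
  assume h: "h \<in> dimonoid_auto D (\<stileturn>) (\<turnstile>)"
  then have hleft: "h (x \<stileturn> y) = h x \<stileturn> h y" and hright: "h (x \<turnstile> y) = h x \<turnstile> h y"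
    if "x \<in> D" "y \<in> D" for x y
    using that by (auto simp: dimonoid_auto_def)
  have B: "h \<in> Bij D"
    using h by (auto simp: dimonoid_auto_def)
  have hD: "h x \<in> D" if "x \<in> D" for x
    using Bij_imp_funcset[OF B] that by auto
  have inj: "inj_on h D"
    using B by (auto simp: Bij_iff bij_betw_def)
  obtain b where b: "b \<in> D" "b \<notin> A"
    using A by auto
  have aD: "a \<in> D" "zero \<in> D"
    using A by auto
  have zero: "h zero = zero"
    using hleft[OF b(1) b(1)] b hD by (simp add: left)
  \<comment> \<open>For \<open>y\<close> in \<open>A\<close>,
    \<open>h y = h (y \<turnstile> y) = h y \<turnstile> h y\<close>, which is a value of
    \<open>\<turnstile>\<close> and hence in \<open>A\<close>.\<close>
  have hA: "h y \<in> A" if "y \<in> A" for y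
  proof -
    have "y \<in> D"
      using that A by auto
    then show ?thesis
      using hright[of y y] that hD[of y] A by (auto simp: right split: if_splits)
  qed
  \<comment> \<open>Applying \<open>h\<close> to \<open>y \<turnstile> y = a\<close> gives
    \<open>h a = h y \<turnstile> h y\<close>. If \<open>h y\<close> were in \<open>A\<close>, this
    would be \<open>h y\<close>, and injectivity would force \<open>y = a\<close>, contradicting
    \<open>y \<notin> A\<close>.\<close>
  have *: "h y \<notin> A \<and> h a = a" if y: "y \<in> D" "y \<notin> A" for y
  proof (cases "h y \<in> A")
    case True
    then have "h a = h y"
      using hright[OF y(1) y(1)] y hD by (simp add: right)
    with inj y A aD show ?thesis
      by (auto dest: inj_onD)
  next
    case False
    then show ?thesis
      using hright[OF y(1) y(1)] y hD by (simp add: right)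
  qed
  have "h y \<noteq> zero" "h y \<noteq> a" if "y \<in> D" "y \<noteq> zero" "y \<noteq> a" for y
    using inj that aD zero *[OF b] by (metis inj_onD)+
  then have "h ` (A - {zero, a}) \<subseteq> A - {zero, a}"
    using A hA by blast
  \<comment> \<open>Only \<open>zero\<close> and \<open>a\<close> lie outside both blocks.\<close>
  with B zero hD * b show "h \<in> block_bijs D (A - {zero, a}) (D - A)"
    by (auto simp: block_bijs_def)
next
  fix h
  assume h: "h \<in> block_bijs D (A - {zero, a}) (D - A)"
  then have B: "h \<in> Bij D" and fixed: "h zero = zero" "h a = a"
    and stable: "y \<in> A - {zero, a} \<Longrightarrow> h y \<in> A - {zero, a}" "y \<in> D - A \<Longrightarrow> h y \<in> D - A" for y
    using A by (auto simp: block_bijs_def)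
  have hD: "h x \<in> D" if "x \<in> D" for x
    using Bij_imp_funcset[OF B] that by auto
  \<comment> \<open>This makes \<open>h\<close> respect the case distinction in
    \<open>\<turnstile>\<close>.\<close>
  have "h y \<in> A \<longleftrightarrow> y \<in> A" if "y \<in> D" for y
    using that stable[of y] fixed A by (cases "y = zero \<or> y = a") auto
  then show "h \<in> dimonoid_auto D (\<stileturn>) (\<turnstile>)"
    using B fixed hD by (simp add: dimonoid_auto_def left right)
qed

theorem corollary3p8:
  fixes D A :: "'a set" and a zero :: 'a
    and left_op :: "'a \<Rightarrow> 'a \<Rightarrow> 'a" (infixl \<open>\<stileturn>\<close> 70)
    and right_op :: "'a \<Rightarrow> 'a \<Rightarrow> 'a" (infixl \<open>\<turnstile>\<close> 70)
  assumes "A \<subset> D" and "a \<in> A" and "zero \<in> A"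
    and "\<And>x y. \<lbrakk>x \<in> D; y \<in> D\<rbrakk> \<Longrightarrow> x \<stileturn> y = zero"
    and "\<And>x y. \<lbrakk>x \<in> D; y \<in> D\<rbrakk> \<Longrightarrow> x \<turnstile> y = (if y \<in> A then y else a)"
  shows "rectangular_dimonoid D (\<stileturn>) (\<turnstile>) \<and>
    halo D (\<stileturn>) (\<turnstile>) = {} \<and>
    dimonoid_AutGroup D (\<stileturn>) (\<turnstile>) \<cong> BijGroup (A - {zero, a}) \<times>\<times> BijGroup (D - A) \<and>
    ((infinite A \<or> card A > 1) \<longrightarrow>
      dimonoid D (\<stileturn>) (\<turnstile>) \<and>
      \<not> abelian_dimonoid D (\<stileturn>) (\<turnstile>) \<and> \<not> commutative_dimonoid D (\<stileturn>) (\<turnstile>))"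
proof (intro conjI impI)
  note left = assms(4) and right = assms(5)
  have mem: "a \<in> D" "zero \<in> D"
    using assms(1-3) by auto
  \<comment> \<open>Iterated products collapse since \<open>x \<turnstile> y\<close> depends only on
    \<open>y\<close>, lies in \<open>A\<close>, and equals \<open>y\<close> for \<open>y\<close> in
    \<open>A\<close>; in particular \<open>x \<turnstile> zero = zero\<close>, as D2
    requires.\<close>
  have dim: "dimonoid D (\<stileturn>) (\<turnstile>)"
    using mem assms(2,3) by unfold_locales (simp_all add: left right)
  then show "dimonoid D (\<stileturn>) (\<turnstile>)" .
  have "rectangular_semigroup D (\<stileturn>)" "rectangular_semigroup D (\<turnstile>)"
    using mem assms(2,3) by (unfold_locales; simp add: left right)+
  with dim show "rectangular_dimonoid D (\<stileturn>) (\<turnstile>)"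
    by (simp add: rectangular_dimonoid_def rectangular_dimonoid_axioms_def)
  show "halo D (\<stileturn>) (\<turnstile>) = {}"
  proof -
    \<comment> \<open>A bar-unit \<open>e\<close> would give
      \<open>b = b \<stileturn> e = zero\<close>, but \<open>zero\<close> is in
      \<open>A\<close>.\<close>
    obtain b where "b \<in> D" "b \<notin> A"
      using assms(1) by auto
    then show ?thesis
      using assms(3) by (force simp: halo_def left)
  qed
  show "dimonoid_AutGroup D (\<stileturn>) (\<turnstile>) \<cong> BijGroup (A - {zero, a}) \<times>\<times> BijGroup (D - A)"
  proof -
    have "dimonoid_auto D (\<stileturn>) (\<turnstile>) = block_bijs D (A - {zero, a}) (D - A)"
      using assms by (rule dimonoid_auto_eq_block_bijs)
    then show ?thesis
      unfolding dimonoid_AutGroup_def using assms(1) by (auto intro!: block_bijs_iso)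
  qed
  \<comment> \<open>As \<open>card\<close> is 0 on infinite sets, |A| > 1 needs the separate
    infinite case.\<close>
  assume "infinite A \<or> card A > 1"
  then have "A \<noteq> {zero}"
    by auto
  then obtain c where c: "c \<in> A" "c \<noteq> zero"
    using assms(3) by auto
  have cD: "c \<in> D"
    using c assms(1) by auto
  \<comment> \<open>Here \<open>c \<stileturn> c = zero\<close> while
    \<open>c \<turnstile> c = c\<close>.\<close>
  show "\<not> abelian_dimonoid D (\<stileturn>) (\<turnstile>)"
    using abelian_dimonoid.abelian[of D "(\<stileturn>)" "(\<turnstile>)" c c] c cD by (auto simp: left right)
  \<comment> \<open>Already \<open>\<turnstile>\<close> fails to commute:
    \<open>c \<turnstile> zero = zero\<close> but \<open>zero \<turnstile> c = c\<close>.\<close>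
  show "\<not> commutative_dimonoid D (\<stileturn>) (\<turnstile>)"
    using commutative_dimonoid.right_commute[of D "(\<stileturn>)" "(\<turnstile>)" c zero] c cD mem assms(3)
    by (auto simp: left right)
qed

end
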